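(* Let $\bar\alpha_1=1$ and $\bar\alpha_{k+1}=\dfrac{2}{1+\sqrt{1+4/\bar\alpha_k^2}}$ for $k\ge1$. For every integer $k\ge8$, the quantity $$\frac{2}{\left(1+a\cdot k^{-b}\right)k+1},$$ regarded as a function of $(a,b)$ with $a>0$, $0<b<1$ subject to the constraint $$a(1-b)\cdot 2^{2-b}-ab(1-b)\cdot2^{-b}-1\ge0,$$ is maximized at $$\bar a_k=\frac{2^{\bar b_k}}{(1-\bar b_k)(4-\bar b_k)}\quad\text{and}\quad \bar b_k=\frac{2+5\left(\log\frac2k\right)+\sqrt{9\left(\log\frac2k\right)^2+4}}{2\left(\log\frac2k\right)}.$$ Consequently, $$\frac{k+1}{2}-\bar\alpha_k^{-1}=O(\log k)\qquad (k\to\infty).$$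
   Context: $\log$ denotes the natural logarithm. The displayed function of $(a,b)$ is a lower bound for $\bar\alpha_k$ for every admissible $(a,b)$, and $\bar\alpha_k\le\frac{2}{k+1}$. *)

theory Defs
  imports Complex_Main "HOL-Library.Landau_Symbols"
begin

definition alpha_lower :: "nat \<Rightarrow> real \<times> real \<Rightarrow> real" where
  "alpha_lower k = (\<lambda>(a, b). 2 / ((1 + a * real k powr (- b)) * real k + 1))"

definition admissible :: "real \<times> real \<Rightarrow> bool" where
  "admissible = (\<lambda>(a, b). a > 0 \<and> 0 < b \<and> b < 1 \<and>
     a * (1 - b) * 2 powr (2 - b) - a * b * (1 - b) * 2 powr (- b) - 1 \<ge> 0)"

definition b_bar :: "nat \<Rightarrow> real" where
  "b_bar k = (2 + 5 * ln (2 / real k) + sqrt (9 * (ln (2 / real k))\<^sup>2 + 4))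
               / (2 * ln (2 / real k))"

definition a_bar :: "nat \<Rightarrow> real" where
  "a_bar k = 2 powr b_bar k / ((1 - b_bar k) * (4 - b_bar k))"

end

theory Submission imports Defs begin

text \<open>
  The constraint says \<open>a \<ge> 2\<^sup>b / ((1 - b) (4 - b))\<close>, so the problem is to minimise the convex function
  \<open>b L - ln (1 - b) - ln (4 - b)\<close> with \<open>L = ln (2 / k)\<close>, whose critical point is a root of a
  quadratic; the root lies in \<open>(0, 1)\<close> as soon as \<open>L < -5/4\<close>, which holds for \<open>k \<ge> 8\<close>.

  For the asymptotics, \<open>u = 1 / \<alpha>\<close> satisfies \<open>u (k + 1) = (1 + sqrt (1 + 4 u(k)\<^sup>2)) / 2\<close>, hence
  \<open>1/2 \<le> u (k + 1) - u k \<le> 1/2 + 1 / (8 u k)\<close>; the lower bound gives \<open>u k \<ge> (k + 1) / 2\<close>, and then the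
  excess increments are dominated by \<open>(ln (k + 1) - ln k) / 4\<close>.
\<close>

text \<open>As \<open>2 powr (2 - b)\<close> is four times \<open>2 powr (- b)\<close>, the left
  side of the constraint factors. The condition \<open>a > 0\<close> is absorbed by the positive
  lower bound.\<close>

lemma admissible_iff:
  "admissible (a, b) \<longleftrightarrow> 0 < b \<and> b < 1 \<and> 2 powr b / ((1 - b) * (4 - b)) \<le> a"
proof (cases "0 < b \<and> b < 1")
  case True
  have "a * (1 - b) * 2 powr (2 - b) - a * b * (1 - b) * 2 powr (- b) - 1
      = a * ((1 - b) * (4 - b)) / 2 powr b - 1"
    by (simp add: powr_diff powr_minus field_simps)
  moreover have "a * ((1 - b) * (4 - b)) / 2 powr b - 1 \<ge> 0 \<longleftrightarrow> 2 powr b / ((1 - b) * (4 - b)) \<le> a"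
    using True by (simp add: pos_le_divide_eq pos_divide_le_eq)
  moreover have "0 < 2 powr b / ((1 - b) * (4 - b))"
    using True by simp
  ultimately show ?thesis
    using True unfolding admissible_def by (smt (verit) case_prod_conv)
qed (auto simp: admissible_def)

lemma ln_ge_tangent:
  fixes x y :: real
  assumes "0 < x" "0 < y"
  shows "ln x \<le> ln y + (x - y) / y"
  using ln_le_minus_one[of "x / y"] assms by (simp add: ln_div diff_divide_distrib)

text \<open>Taking logarithms makes the function convex, so tangent lines at \<open>b\<close>
  replace any differentiation.\<close>

lemma critical_point_minimizes:
  fixes L b x :: real
  assumes "b < 1" "x < 1" and crit: "L + 1 / (1 - b) + 1 / (4 - b) = 0"
  shows "exp (b * L) / ((1 - b) * (4 - b)) \<le> exp (x * L) / ((1 - x) * (4 - x))"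
proof -
  have "ln (1 - x) \<le> ln (1 - b) + (b - x) / (1 - b)" "ln (4 - x) \<le> ln (4 - b) + (b - x) / (4 - b)"
    using ln_ge_tangent[of "1 - x" "1 - b"] ln_ge_tangent[of "4 - x" "4 - b"] assms by simp_all
  \<comment> \<open>The linear terms of the two tangents combine with \<open>b * L - x * L\<close>
    to \<open>b - x\<close> times the derivative at \<open>b\<close>, which is zero.\<close>
  moreover have "(b - x) * (L + 1 / (1 - b) + 1 / (4 - b)) = 0"
    using crit by simp
  then have "b * L - x * L + (b - x) / (1 - b) + (b - x) / (4 - b) = 0"
    by (simp add: algebra_simps diff_divide_distrib)
  ultimately have "b * L - ln (1 - b) - ln (4 - b) \<le> x * L - ln (1 - x) - ln (4 - x)"
    by linarith
  then have "exp (b * L - ln (1 - b) - ln (4 - b)) \<le> exp (x * L - ln (1 - x) - ln (4 - x))"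
    by simp
  then show ?thesis
    using assms by (simp add: exp_diff)
qed

text \<open>Clearing denominators gives \<open>L * b^2 - (5 * L + 2) * b + 4 * L + 5 = 0\<close>,
  with discriminant \<open>9 * L^2 + 4\<close>. Since \<open>L < 0\<close>, the plus sign selects
  the smaller root.\<close>

lemma smaller_root_critical:
  fixes L b :: real
  assumes L: "L < - 5 / 4" and b: "b = (2 + 5 * L + sqrt (9 * L\<^sup>2 + 4)) / (2 * L)"
  shows "0 < b" "b < 1" "L + 1 / (1 - b) + 1 / (4 - b) = 0"
proof -
  define s where "s = sqrt (9 * L\<^sup>2 + 4)"
  have s2: "s\<^sup>2 = 9 * L\<^sup>2 + 4"
    unfolding s_def by (rule real_sqrt_pow2) simp
  have bL: "2 * L * b = 2 + 5 * L + s"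
    using b L by (simp add: s_def)
  have "s > - 3 * L - 2"
  proof (rule power2_less_imp_less)
    show "(- 3 * L - 2)\<^sup>2 < s\<^sup>2"
      unfolding s2 using L by (simp add: power2_eq_square algebra_simps)
  qed (simp add: s_def)
  \<comment> \<open>This is \<open>0 < b\<close>, and the source of \<open>- 5 / 4\<close>: the
    squares differ by \<open>L * (16 * L + 20)\<close>.\<close>
  have "s < - 2 - 5 * L"
  proof (rule power2_less_imp_less)
    have "L * (16 * L + 20) > 0"
      using L by (intro mult_neg_neg) auto
    then show "s\<^sup>2 < (- 2 - 5 * L)\<^sup>2"
      unfolding s2 by (simp add: power2_eq_square algebra_simps)
  qed (use L in simp)
  show "0 < b"
    using b L \<open>s < - 2 - 5 * L\<close> by (simp add: s_def zero_less_divide_iff)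
  show "b < 1"
    using b L \<open>s > - 3 * L - 2\<close> by (simp add: s_def divide_less_eq)
  have "(2 * L * b - 2 - 5 * L)\<^sup>2 = 9 * L\<^sup>2 + 4"
    using bL s2 by simp
  then have "4 * L * (L * ((1 - b) * (4 - b)) + (5 - 2 * b)) = 0"
    by (simp add: power2_eq_square algebra_simps)
  then have "L * ((1 - b) * (4 - b)) + (5 - 2 * b) = 0"
    using L by simp
  then show "L + 1 / (1 - b) + 1 / (4 - b) = 0"
    using \<open>b < 1\<close> by (simp add: field_simps)
qed

text \<open>At \<open>x = 8\<close> the claim is \<open>5 / 4 < ln 4\<close>, which follows from
  \<open>exp 1 ^ 5\<close> being at most 243, below \<open>4 ^ 4 = 256\<close>.\<close>

lemma ln_two_div_less:
  fixes x :: real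
  assumes "x \<ge> 8"
  shows "ln (2 / x) < - 5 / 4"
proof -
  have "exp (5 / 4 :: real) ^ 4 = exp 1 ^ 5"
    by (simp flip: exp_of_nat_mult)
  also have "\<dots> \<le> (3 :: real) ^ 5"
    by (rule power_mono) (use exp_le in auto)
  also have "\<dots> < 4 ^ 4"
    by simp
  finally have "exp (5 / 4 :: real) < 4"
    by (rule power_less_imp_less_base) simp
  then have "5 / 4 < ln (4 :: real)"
    by (metis exp_less_cancel_iff exp_ln zero_less_numeral)
  also have "\<dots> \<le> ln (x / 2)"
    using assms by simp
  also have "\<dots> = - ln (2 / x)"
    using assms by (simp add: ln_div)
  finally show ?thesis
    by simp
qed

lemma a_bar_b_bar_is_arg_max:
  assumes "k \<ge> 8"
  shows "is_arg_max (alpha_lower k) admissible (a_bar k, b_bar k)"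
proof -
  define L where "L = ln (2 / real k)"
  have "L < - 5 / 4"
    unfolding L_def by (rule ln_two_div_less) (use assms in simp)
  then have root: "0 < b_bar k" "b_bar k < 1" "L + 1 / (1 - b_bar k) + 1 / (4 - b_bar k) = 0"
    by (rule smaller_root_critical, simp add: b_bar_def L_def)+
  \<comment> \<open>With the least admissible \<open>a\<close>, the term
    \<open>a * k powr (- b)\<close> to be minimised depends on \<open>b\<close> alone.\<close>
  have powr_L: "2 powr x / ((1 - x) * (4 - x)) * real k powr - x = exp (x * L) / ((1 - x) * (4 - x))"
    for x
    using assms by (simp add: L_def powr_def ln_div exp_diff exp_minus field_simps)
  have "alpha_lower k (a, b) \<le> alpha_lower k (a_bar k, b_bar k)" if ab: "admissible (a, b)" for a b
  proof -
    have "a_bar k * real k powr - b_bar k \<le> 2 powr b / ((1 - b) * (4 - b)) * real k powr - b"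
      using critical_point_minimizes[OF root(2) _ root(3), of b] ab
      unfolding a_bar_def powr_L by (simp add: admissible_iff)
    also have "\<dots> \<le> a * real k powr - b"
      using ab by (intro mult_right_mono) (auto simp: admissible_iff)
    finally have "(1 + a_bar k * real k powr - b_bar k) * real k + 1
        \<le> (1 + a * real k powr - b) * real k + 1"
      by (simp add: mult_right_mono)
    moreover have "a_bar k > 0"
      using root by (simp add: a_bar_def)
    then have "0 < (1 + a_bar k * real k powr - b_bar k) * real k + 1"
      by (intro add_nonneg_pos mult_nonneg_nonneg) auto
    ultimately show ?thesis
      unfolding alpha_lower_def by (simp add: frac_le)
  qed
  moreover have "admissible (a_bar k, b_bar k)"
    using root by (simp add: admissible_iff a_bar_def)
  ultimately show ?thesis
    unfolding is_arg_max_def by (auto simp: not_less)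
qed

lemma sqrt_one_add_sq_bounds:
  fixes u :: real
  assumes "u > 0"
  shows "2 * u \<le> sqrt (1 + 4 * u\<^sup>2)" "sqrt (1 + 4 * u\<^sup>2) \<le> 2 * u + 1 / (4 * u)"
proof -
  show "2 * u \<le> sqrt (1 + 4 * u\<^sup>2)"
    by (rule real_le_rsqrt) (simp add: power_mult_distrib)
  \<comment> \<open>The summand \<open>1 / (4 * u)\<close> is chosen so that the cross term of the
    square is exactly 1.\<close>
  have "(2 * u + 1 / (4 * u))\<^sup>2 = 1 + 4 * u\<^sup>2 + (1 / (4 * u))\<^sup>2"
    using assms by (simp add: power2_eq_square field_simps)
  then show "sqrt (1 + 4 * u\<^sup>2) \<le> 2 * u + 1 / (4 * u)"
    using assms by (intro real_le_lsqrt) simp_all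
qed

text \<open>One induction carries both bounds, because the upper one uses the lower one to control
  \<open>1 / (4 * u j)\<close>.\<close>

lemma inverse_recurrence_bounds:
  fixes u :: "nat \<Rightarrow> real"
  assumes "u 1 = 1" and rec: "\<And>k. k \<ge> 1 \<Longrightarrow> u (k + 1) = (1 + sqrt (1 + 4 * (u k)\<^sup>2)) / 2"
    and "k \<ge> 1"
  shows "(real k + 1) / 2 \<le> u k \<and> u k \<le> (real k + 1) / 2 + ln (real k) / 4"
  using \<open>k \<ge> 1\<close>
proof (induction k rule: dec_induct)
  case base
  then show ?case
    using assms by simp
next
  case (step j)
  then have "u j > 0"
    by (smt (verit) divide_pos_pos of_nat_0_le_iff)
  \<comment> \<open>The tangent is taken at the right endpoint \<open>j + 1\<close>, matching the
    denominator that the lower bound on \<open>u j\<close> supplies.\<close>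
  have log_step: "1 / (real j + 1) \<le> ln (real (Suc j)) - ln (real j)"
    using ln_ge_tangent[of "real j" "real j + 1"] step by (simp add: add.commute)
  have "1 / (4 * u j) \<le> 1 / (2 * (real j + 1))"
    using step \<open>u j > 0\<close> by (intro frac_le) auto
  also have "\<dots> = (1 / (real j + 1)) / 2"
    by simp
  also have "\<dots> \<le> (ln (real (Suc j)) - ln (real j)) / 2"
    using log_step by (rule divide_right_mono) simp
  finally have "sqrt (1 + 4 * (u j)\<^sup>2) \<le> 2 * u j + (ln (real (Suc j)) - ln (real j)) / 2"
    using sqrt_one_add_sq_bounds(2)[OF \<open>u j > 0\<close>] by linarith
  moreover have "u (Suc j) = (1 + sqrt (1 + 4 * (u j)\<^sup>2)) / 2"
    using rec[of j] step by simp
  ultimately show ?case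
    using sqrt_one_add_sq_bounds(1)[OF \<open>u j > 0\<close>] step.IH by (simp add: field_simps)
qed

theorem corollary1:
  fixes \<alpha> :: "nat \<Rightarrow> real"
  assumes "\<alpha> 1 = 1"
    and "\<And>k. k \<ge> 1 \<Longrightarrow> \<alpha> (k + 1) = 2 / (1 + sqrt (1 + 4 / (\<alpha> k)\<^sup>2))"
  shows "(\<forall>k\<ge>8. is_arg_max (alpha_lower k) admissible (a_bar k, b_bar k)) \<and>
         (\<lambda>k. (real k + 1) / 2 - inverse (\<alpha> k)) \<in> O(\<lambda>k. ln (real k))"
proof
  show "\<forall>k\<ge>8. is_arg_max (alpha_lower k) admissible (a_bar k, b_bar k)"
    by (simp add: a_bar_b_bar_is_arg_max)
  have bounds: "(real k + 1) / 2 \<le> inverse (\<alpha> k) \<and> inverse (\<alpha> k) \<le> (real k + 1) / 2 + ln (real k) / 4"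
    if "k \<ge> 1" for k
  proof (rule inverse_recurrence_bounds[OF _ _ that])
    show "inverse (\<alpha> (j + 1)) = (1 + sqrt (1 + 4 * (inverse (\<alpha> j))\<^sup>2)) / 2" if "j \<ge> 1" for j
      unfolding assms(2)[OF that] by (simp add: inverse_eq_divide power_divide)
  qed (use assms(1) in simp)
  show "(\<lambda>k. (real k + 1) / 2 - inverse (\<alpha> k)) \<in> O(\<lambda>k. ln (real k))"
  proof (rule bigoI)
    show "\<forall>\<^sub>F k in sequentially. norm ((real k + 1) / 2 - inverse (\<alpha> k)) \<le> 1 / 4 * norm (ln (real k))"
      using eventually_ge_at_top[of 1]
    proof eventually_elim
      case (elim k)
      then have "0 \<le> ln (real k)"
        by simp
      then show ?case
        using bounds[OF elim] unfolding real_norm_def by linarith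
    qed
  qed
qed

end
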